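(* If $g$ is a regular kernel on the finite alphabet $S$ that satisfies the $\ell^2$ criterion, i.e. $\sum_{k=1}^\infty\mathrm{var}_k(g)^2<\infty$, then $g$ exhibits dynamic uniqueness.
   Context: $S$ is a finite set, $\mathcal X=S^{\mathbb Z}$, $\mathcal X^-=S^{\{-1,-2,\dots\}}$. Sequences are written with the past to the right: $x_j^i=(x_i,\dots,x_j)$ for $j\le i$, $x_{-\infty}^i=(x_i,x_{i-1},\dots)$, $\underline x=x_{-\infty}^{-1}$; concatenations are read in the same order, sequences indexed by a left half-line of $\mathbb Z$ being identified by shifting indices. For $I\subset\mathbb R$, $\mathcal F_I$ is the $\sigma$-algebra on $\mathcal X$ generated by the coordinates with index in $I\cap\mathbb Z$; $\mathcal F=\mathcal F_{\mathbb R}$ and $\mathcal T^+=\bigcap_{n\ge1}\mathcal F_{[n,\infty)}$. A (probability) kernel $g$ on $S$ is a measurable function assigning to each $a\in S$, $\underline x\in\mathcal X^-$ a number $g(a\underline x)\in[0,1]$ with $\sum_{a\in S}g(a\underline x)=1$ for all $\underline x$. It is strongly non-null if $\inf_{a,\underline x}g(a\underline x)>0$. Its variation rate is $\mathrm{var}_k(g)=\sup_{a\in S}\sup_{\omega_{-k}^{-1}\in S^k}\sup_{\underline x,\underline y\in\mathcal X^-}|g(a\omega_{-k}^{-1}\underline x)-g(a\omega_{-k}^{-1}\underline y)|$; $g$ is continuous if $\mathrm{var}_k(g)\to0$. It is regular if it is strongly non-null and continuous. For $\underline x\in\mathcal X^-$, $P^{\underline x}$ is the probability measure on $(\mathcal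 X,\mathcal F)$, with canonical process $(X_j)_{j\in\mathbb Z}$, under which $X_{-\infty}^{-1}=\underline x$ almost surely and, for $j\ge0$, $P^{\underline x}[X_j=a\mid X_{-\infty}^{j-1}=y_{-\infty}^{j-1}]=g(ay_{-\infty}^{j-1})$. $g$ exhibits dynamic uniqueness if $P^{\underline x}[A]=P^{\underline y}[A]$ for all $A\in\mathcal T^+$ and all $\underline x,\underline y\in\mathcal X^-$. *)

theory Defs
  imports "HOL-Probability.Probability"
begin

(* A past x_{-1}, x_{-2}, ... is the function x :: nat => 's with x i = x_{-1-i}. *)

type_synonym 's past = "nat \<Rightarrow> 's"

definition past_space :: "'s past measure" where
  "past_space = (\<Pi>\<^sub>M i\<in>UNIV. count_space UNIV)"

(* g a x stands for g(a x). *)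

definition kernel :: "('s::finite \<Rightarrow> 's past \<Rightarrow> real) \<Rightarrow> bool" where
  "kernel g \<longleftrightarrow>
     (\<lambda>(a, x). g a x) \<in> borel_measurable (count_space UNIV \<Otimes>\<^sub>M past_space) \<and>
     (\<forall>a x. 0 \<le> g a x \<and> g a x \<le> 1) \<and>
     (\<forall>x. (\<Sum>a\<in>UNIV. g a x) = 1)"

definition strongly_nonnull :: "('s::finite \<Rightarrow> 's past \<Rightarrow> real) \<Rightarrow> bool" where
  "strongly_nonnull g \<longleftrightarrow> (INF (a, x)\<in>UNIV. g a x) > 0"

(* The concatenated past w_{-1}, ..., w_{-k}, x_{-1}, x_{-2}, ... is comb_seq k w x;
   only w 0, ..., w (k - 1) enter, so w stands for an arbitrary element of S^k. *)

definition var :: "nat \<Rightarrow> ('s::finite \<Rightarrow> 's past \<Rightarrow> real) \<Rightarrow> real" where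
  "var k g = (SUP (a, w, x, y)\<in>UNIV. \<bar>g a (comb_seq k w x) - g a (comb_seq k w y)\<bar>)"

definition continuous_kernel :: "('s::finite \<Rightarrow> 's past \<Rightarrow> real) \<Rightarrow> bool" where
  "continuous_kernel g \<longleftrightarrow> (\<lambda>k. var k g) \<longlonglongrightarrow> 0"

definition regular_kernel :: "('s::finite \<Rightarrow> 's past \<Rightarrow> real) \<Rightarrow> bool" where
  "regular_kernel g \<longleftrightarrow> kernel g \<and> strongly_nonnull g \<and> continuous_kernel g"

definition coord_algebra :: "int set \<Rightarrow> (int \<Rightarrow> 's) measure" where
  "coord_algebra I = sigma UNIV {(\<lambda>\<omega>. \<omega> i) -` B | i B. i \<in> I}"

definition tail_events :: "(int \<Rightarrow> 's) set set" where
  "tail_events = (\<Inter>n\<in>{1..}. sets (coord_algebra {n..}))"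

definition past_at :: "int \<Rightarrow> (int \<Rightarrow> 's) \<Rightarrow> 's past" where
  "past_at j \<omega> = (\<lambda>i. \<omega> (j - 1 - int i))"

(* forward_law g x M says that M is the measure P^x: its defining properties
   determine it, and it exists by Ionescu-Tulcea (lemma forward_law_exists). *)

definition forward_law ::
  "('s::finite \<Rightarrow> 's past \<Rightarrow> real) \<Rightarrow> 's past \<Rightarrow> (int \<Rightarrow> 's) measure \<Rightarrow> bool" where
  "forward_law g x M \<longleftrightarrow>
     prob_space M \<and> space M = UNIV \<and> sets M = sets (coord_algebra UNIV) \<and>
     (AE \<omega> in M. past_at 0 \<omega> = x) \<and>
     (\<forall>j\<ge>0. \<forall>a. AE \<omega> in M.
        real_cond_exp M (coord_algebra {..j - 1}) (indicator {\<omega>. \<omega> j = a}) \<omega> = g a (past_at j \<omega>))"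

definition dynamic_uniqueness :: "('s::finite \<Rightarrow> 's past \<Rightarrow> real) \<Rightarrow> bool" where
  "dynamic_uniqueness g \<longleftrightarrow>
     (\<forall>x y M N. forward_law g x M \<longrightarrow> forward_law g y N \<longrightarrow>
        (\<forall>A\<in>tail_events. measure M A = measure N A))"

lemma sets_coord_algebra:
  "sets (coord_algebra I) = sigma_sets UNIV {(\<lambda>\<omega>. \<omega> i) -` B | i B. i \<in> I}"
  by (simp add: coord_algebra_def)

lemma space_coord_algebra [simp]: "space (coord_algebra I) = UNIV"
  by (simp add: coord_algebra_def space_measure_of_conv)

lemma measurable_coord:
  assumes "i \<in> I" shows "(\<lambda>\<omega>. \<omega> i) \<in> measurable (coord_algebra I) (count_space UNIV)"
  using assms by (intro measurableI) (auto simp: sets_coord_algebra)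

lemma sets_coord_algebra_mono:
  "I \<subseteq> J \<Longrightarrow> sets (coord_algebra I) \<subseteq> sets (coord_algebra J)"
  unfolding sets_coord_algebra by (rule sigma_sets_mono') auto

lemma measurable_past_at:
  assumes "{..j - 1} \<subseteq> I"
  shows "past_at j \<in> measurable (coord_algebra I) past_space"
  unfolding past_at_def past_space_def
  by (rule measurable_PiM_single') (use assms in \<open>auto intro!: measurable_coord\<close>)

lemma measurable_into_coord_algebra:
  fixes f :: "'b \<Rightarrow> int \<Rightarrow> 's"
  assumes "\<And>i. i \<in> I \<Longrightarrow> (\<lambda>\<omega>. f \<omega> i) \<in> measurable N (count_space UNIV)"
  shows "f \<in> measurable N (coord_algebra I)"
  unfolding coord_algebra_def
proof (rule measurable_sigma_sets[OF sets_measure_of])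
  fix A :: "(int \<Rightarrow> 's) set"
  assume "A \<in> {(\<lambda>\<omega>. \<omega> i) -` B |i B. i \<in> I}"
  then obtain i and B :: "'s set" where i: "i \<in> I" "A = (\<lambda>\<omega>. \<omega> i) -` B" by auto
  have "(\<lambda>\<omega>. f \<omega> i) -` B \<inter> space N \<in> sets N"
    by (rule measurable_sets[OF assms[OF i(1)]]) auto
  then show "f -` A \<inter> space N \<in> sets N" using i by (simp add: vimage_def)
qed auto

lemma coord_algebra_depends:
  assumes "A \<in> sets (coord_algebra I)" "\<And>i. i \<in> I \<Longrightarrow> \<omega> i = \<omega>' i"
  shows "\<omega> \<in> A \<longleftrightarrow> \<omega>' \<in> A"
  using assms(1) unfolding sets_coord_algebra
  by (induction rule: sigma_sets.induct) (use assms(2) in auto)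

definition glue :: "'s past \<Rightarrow> (nat \<Rightarrow> 's) \<Rightarrow> int \<Rightarrow> 's" where
  "glue x \<omega> i = (if i \<ge> 0 then \<omega> (nat i) else x (nat (- 1 - i)))"

lemma measurable_kernel:
  assumes "kernel g" shows "g a \<in> borel_measurable past_space"
proof -
  have "(\<lambda>x. (\<lambda>(a, x). g a x) (a, x)) \<in> borel_measurable past_space"
    by (rule measurable_compose[OF measurable_Pair1']) (use assms in \<open>auto simp: kernel_def\<close>)
  then show ?thesis by simp
qed

lemma forward_law_exists:
  fixes g :: "'s::finite \<Rightarrow> 's past \<Rightarrow> real"
  assumes g: "kernel g"
  shows "\<exists>M. forward_law g x M"
proof -
  let ?S = "\<lambda>_::nat. count_space (UNIV :: 's set)"
  define q where "q n \<omega> a = g a (past_at (int n) (glue x \<omega>))" for n \<omega> a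
  define K where "K n \<omega> = point_measure UNIV (\<lambda>a. ennreal (q n \<omega> a))" for n :: nat and \<omega>
  have q0: "0 \<le> q n \<omega> a" for n \<omega> a using g by (auto simp: q_def kernel_def)
  have q1: "(\<Sum>a\<in>UNIV. q n \<omega> a) = 1" for n \<omega> using g by (auto simp: q_def kernel_def)
  have glue_meas: "glue x \<in> measurable (PiM I ?S) (coord_algebra J)"
    if "\<And>i. i \<in> J \<Longrightarrow> i \<ge> 0 \<Longrightarrow> nat i \<in> I" for I J
  proof (rule measurable_into_coord_algebra)
    fix i assume "i \<in> J"
    then show "(\<lambda>\<omega>. glue x \<omega> i) \<in> measurable (PiM I ?S) (count_space UNIV)"
      using measurable_component_singleton[of "nat i" I ?S] that[of i]
      by (cases "i \<ge> 0") (auto simp: glue_def[abs_def])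
  qed
  have q_meas [measurable]: "(\<lambda>\<omega>. q n \<omega> a) \<in> borel_measurable (PiM {0..<n} ?S)" for n a
    unfolding q_def
    by (rule measurable_compose[OF glue_meas[of "{..int n - 1}"]
          measurable_compose[OF measurable_past_at measurable_kernel[OF g]]]) auto
  have prob_K: "prob_space (K n \<omega>)" for n \<omega>
    unfolding K_def
    by (rule prob_spaceI)
       (simp add: space_point_measure emeasure_point_measure_finite q0 q1 sum_ennreal)
  have K_emeasure: "emeasure (K n \<omega>) A = (\<Sum>a\<in>A. ennreal (q n \<omega> a))" for n \<omega> A
    unfolding K_def by (simp add: emeasure_point_measure_finite)
  interpret IT: Ionescu_Tulcea K ?S
  proof (rule Ionescu_Tulcea.intro)
    fix n :: nat
    show "K n \<in> measurable (PiM {0..<n} ?S) (subprob_algebra (?S n))"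
    proof (rule measurable_subprob_algebra)
      show "subprob_space (K n \<omega>)" for \<omega>
        using prob_K by (rule prob_space_imp_subprob_space)
      show "sets (K n \<omega>) = sets (?S n)" for \<omega> by (simp add: K_def sets_point_measure)
      show "(\<lambda>\<omega>. emeasure (K n \<omega>) A) \<in> borel_measurable (PiM {0..<n} ?S)" for A
        unfolding K_emeasure by measurable
    qed
  qed (rule prob_K)
  let ?L = IT.PF.lim
  have sets_L [measurable_cong]: "sets ?L = sets (PiM UNIV ?S)" by simp
  have space_L: "space ?L = UNIV" by (simp add: space_PiM)
  have CI_C: "IT.CI {0..<n} = IT.C 0 n (\<lambda>_. undefined)" for n
  proof -
    have "IT.up_to {0..<n} = n"
      by (auto simp: IT.up_to_def intro!: Least_equality)
    then show ?thesis
      unfolding IT.CI_def using IT.distr_C[of n n "\<lambda>_. undefined" 0] by (simp add: space_PiM)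
  qed
  have u: "(\<lambda>_. undefined) \<in> space (PiM {0..<0} ?S)" by (simp add: space_PiM)
  have restr_meas: "(\<lambda>\<omega>. restrict \<omega> {0..<n}) \<in> measurable ?L (PiM {0..<n} ?S)" for n
    unfolding measurable_cong_sets[OF sets_L refl] by (rule measurable_restrict_subset) auto
  have L_C: "(\<integral>\<^sup>+\<omega>. f (restrict \<omega> {0..<n}) \<partial>?L) = (\<integral>\<^sup>+\<omega>. f \<omega> \<partial>IT.C 0 n (\<lambda>_. undefined))"
    if "f \<in> borel_measurable (PiM {0..<n} ?S)" for f n
    unfolding CI_C[symmetric] IT.distr_lim[of "{0..<n}", OF finite_atLeastLessThan, symmetric]
    by (subst nn_integral_distr[OF restr_meas]) (use that in simp_all)
  interpret L: prob_space ?L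
  proof (rule prob_space_distrD)
    show "prob_space (distr ?L (PiM {0..<0} ?S) (\<lambda>\<omega>. restrict \<omega> {0..<0}))"
      by (subst IT.distr_lim) (auto intro: IT.PF.prob_space_P)
  qed (rule restr_meas)
  have step: "(\<integral>\<^sup>+\<omega>. indicator B (restrict \<omega> {0..<n}) * indicator {a} (\<omega> n) \<partial>?L) =
              (\<integral>\<^sup>+\<omega>. indicator B (restrict \<omega> {0..<n}) * ennreal (q n \<omega> a) \<partial>?L)"
    if B [measurable]: "B \<in> sets (PiM {0..<n} ?S)" for B n a
  proof -
    let ?f = "\<lambda>\<omega>. indicator B (restrict \<omega> {0..<n}) * indicator {a} (\<omega> n) :: ennreal"
    have r [measurable]: "(\<lambda>\<omega>. restrict \<omega> {0..<n}) \<in> measurable (PiM {0..<Suc n} ?S) (PiM {0..<n} ?S)"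
      by (rule measurable_restrict_subset) auto
    have c [measurable]: "(\<lambda>\<omega>. \<omega> n) \<in> measurable (PiM {0..<Suc n} ?S) (count_space UNIV)"
      by (rule measurable_component_singleton) auto
    have f [measurable]: "?f \<in> borel_measurable (PiM {0..<Suc n} ?S)" by measurable
    have "(\<integral>\<^sup>+\<omega>. ?f \<omega> \<partial>?L) = (\<integral>\<^sup>+\<omega>. ?f (restrict \<omega> {0..<Suc n}) \<partial>?L)"
      by (intro nn_integral_cong) (simp add: Int_absorb1)
    also have "\<dots> = (\<integral>\<^sup>+\<omega>. ?f \<omega> \<partial>IT.C 0 (Suc n) (\<lambda>_. undefined))"
      by (rule L_C[OF f])
    also have "\<dots> = (\<integral>\<^sup>+\<omega>. \<integral>\<^sup>+\<omega>'. ?f \<omega>' \<partial>IT.eP n \<omega> \<partial>IT.C 0 n (\<lambda>_. undefined))"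
    proof -
      have "IT.eP n \<in> measurable (IT.C 0 n (\<lambda>_. undefined)) (subprob_algebra (PiM {0..<Suc n} ?S))"
        using IT.measurable_eP[of n] IT.sets_C[OF u, of n] by (simp cong: measurable_cong_sets)
      then show ?thesis by (simp add: nn_integral_bind[OF f])
    qed
    also have "\<dots> = (\<integral>\<^sup>+\<omega>. indicator B \<omega> * ennreal (q n \<omega> a) \<partial>IT.C 0 n (\<lambda>_. undefined))"
    proof (rule nn_integral_cong)
      fix \<omega> assume "\<omega> \<in> space (IT.C 0 n (\<lambda>_. undefined))"
      then have w: "\<omega> \<in> space (PiM {0..<n} ?S)" using IT.space_C[OF u, of n] by simp
      then have wr: "restrict (fun_upd \<omega> n y) {0..<n} = \<omega>" for y
        by (auto simp: space_PiM PiE_def extensional_def restrict_def)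
      have "(\<integral>\<^sup>+\<omega>'. ?f \<omega>' \<partial>IT.eP n \<omega>) = (\<integral>\<^sup>+y. ?f (fun_upd \<omega> n y) \<partial>K n \<omega>)"
        by (rule IT.nn_integral_eP[OF w f])
      also have "\<dots> = (\<integral>\<^sup>+y. indicator B \<omega> * indicator {a} y \<partial>K n \<omega>)"
        by (simp only: wr fun_upd_same)
      also have "\<dots> = indicator B \<omega> * emeasure (K n \<omega>) {a}"
        by (subst nn_integral_cmult_indicator) (auto simp: K_def sets_point_measure)
      finally show "(\<integral>\<^sup>+\<omega>'. ?f \<omega>' \<partial>IT.eP n \<omega>) = indicator B \<omega> * ennreal (q n \<omega> a)"
        by (simp add: K_emeasure)
    qed
    also have "\<dots> = (\<integral>\<^sup>+\<omega>. indicator B (restrict \<omega> {0..<n}) * ennreal (q n (restrict \<omega> {0..<n}) a) \<partial>?L)"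
      by (rule L_C[symmetric]) measurable
    also have "\<dots> = (\<integral>\<^sup>+\<omega>. indicator B (restrict \<omega> {0..<n}) * ennreal (q n \<omega> a) \<partial>?L)"
    proof (intro nn_integral_cong)
      fix \<omega> :: "nat \<Rightarrow> 's"
      have "past_at (int n) (glue x (restrict \<omega> {0..<n})) = past_at (int n) (glue x \<omega>)"
        by (rule ext) (auto simp: past_at_def glue_def)
      then show "indicator B (restrict \<omega> {0..<n}) * ennreal (q n (restrict \<omega> {0..<n}) a) =
          indicator B (restrict \<omega> {0..<n}) * ennreal (q n \<omega> a)"
        by (simp add: q_def)
    qed
    finally show ?thesis .
  qed
  define M where "M = distr ?L (coord_algebra UNIV) (glue x)"
  have gl: "glue x \<in> measurable ?L (coord_algebra UNIV)"
    unfolding measurable_cong_sets[OF sets_L refl] by (rule glue_meas) auto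
  interpret M: prob_space M unfolding M_def by (rule L.prob_space_distr[OF gl])
  have sets_M: "sets M = sets (coord_algebra UNIV)" and space_M: "space M = UNIV"
    by (simp_all add: M_def)
  have past0: "past_at 0 (glue x \<omega>) = x" for \<omega>
    by (rule ext) (auto simp: past_at_def glue_def)
  have "AE \<omega> in M. past_at 0 \<omega> = x"
  proof -
    have "{\<omega>. past_at 0 \<omega> = x} = (\<Inter>i. {\<omega> :: int \<Rightarrow> 's. \<omega> (- 1 - int i) = x i})"
      by (auto simp: past_at_def fun_eq_iff)
    also have "\<dots> \<in> sets (coord_algebra UNIV)"
    proof (intro sets.countable_INT)
      show "range (\<lambda>i. {\<omega> :: int \<Rightarrow> 's. \<omega> (- 1 - int i) = x i}) \<subseteq> sets (coord_algebra UNIV)"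
      proof safe
        fix i :: nat
        show "{\<omega> :: int \<Rightarrow> 's. \<omega> (- 1 - int i) = x i} \<in> sets (coord_algebra UNIV)"
          using measurable_sets[OF measurable_coord[of "- 1 - int i" UNIV], of "{x i}"]
          by (simp add: vimage_def)
      qed
    qed simp
    finally have "{\<omega> \<in> space (coord_algebra UNIV). past_at 0 \<omega> = x} \<in> sets (coord_algebra UNIV)"
      by simp
    then show ?thesis unfolding M_def by (subst AE_distr_iff[OF gl]) (auto simp: past0)
  qed
  moreover have "AE \<omega> in M. real_cond_exp M (coord_algebra {..j - 1}) (indicator {\<omega>. \<omega> j = a}) \<omega>
      = g a (past_at j \<omega>)" if "j \<ge> 0" for j a
  proof -
    define n where "n = nat j"
    then have n: "j = int n" using that by simp
    let ?F = "coord_algebra {..j - 1} :: (int \<Rightarrow> 's) measure"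
    have subF: "sets ?F \<subseteq> sets M" unfolding sets_M by (rule sets_coord_algebra_mono) simp
    interpret F: finite_measure_subalgebra M ?F
      by unfold_locales (use subF in \<open>auto simp: subalgebra_def space_M\<close>)
    let ?h = "\<lambda>\<omega>. g a (past_at j \<omega>)"
    have h_F: "?h \<in> borel_measurable ?F"
      by (rule measurable_compose[OF measurable_past_at measurable_kernel[OF g]]) simp
    have h_M [measurable]: "?h \<in> borel_measurable M"
      by (rule measurable_from_subalg[OF F.subalg h_F])
    have h_U: "?h \<in> borel_measurable (coord_algebra UNIV)"
      using h_M by (simp add: measurable_cong_sets[OF sets_M refl])
    have J_U: "{\<omega> :: int \<Rightarrow> 's. \<omega> j = a} \<in> sets (coord_algebra UNIV)"
      using measurable_sets[OF measurable_coord[of j UNIV], of "{a}"] by (simp add: vimage_def)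
    then have J [measurable]: "{\<omega> :: int \<Rightarrow> 's. \<omega> j = a} \<in> sets M" by (simp add: sets_M)
    have h01: "0 \<le> ?h \<omega>" "?h \<omega> \<le> 1" for \<omega> using g by (auto simp: kernel_def)
    show ?thesis
    proof (rule F.real_cond_exp_charact)
      fix A assume A: "A \<in> sets ?F"
      then have A_M [measurable]: "A \<in> sets M" using subF by auto
      then have A_U: "A \<in> sets (coord_algebra UNIV)" by (simp add: sets_M)
      define B where "B = glue x -` A \<inter> space (PiM {0..<n} ?S)"
      have B: "B \<in> sets (PiM {0..<n} ?S)"
        unfolding B_def by (rule measurable_sets[OF glue_meas A]) (auto simp: n)
      have AB: "glue x \<omega> \<in> A \<longleftrightarrow> restrict \<omega> {0..<n} \<in> B" for \<omega>
      proof -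
        have "glue x \<omega> \<in> A \<longleftrightarrow> glue x (restrict \<omega> {0..<n}) \<in> A"
          by (rule coord_algebra_depends[OF A]) (auto simp: glue_def n)
        then show ?thesis by (simp add: B_def space_PiM)
      qed
      have "(\<integral>\<^sup>+\<omega>. indicator A \<omega> * indicator {\<omega>. \<omega> j = a} \<omega> \<partial>M) =
          (\<integral>\<^sup>+\<omega>. indicator A (glue x \<omega>) * indicator {\<omega>. \<omega> j = a} (glue x \<omega>) \<partial>?L)"
        unfolding M_def by (subst nn_integral_distr[OF gl]) (use A_U J_U in simp_all)
      also have "\<dots> = (\<integral>\<^sup>+\<omega>. indicator B (restrict \<omega> {0..<n}) * indicator {a} (\<omega> n) \<partial>?L)"
        by (intro nn_integral_cong) (auto simp: AB glue_def n split: split_indicator)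
      also have "\<dots> = (\<integral>\<^sup>+\<omega>. indicator B (restrict \<omega> {0..<n}) * ennreal (q n \<omega> a) \<partial>?L)"
        by (rule step[OF B])
      also have "\<dots> = (\<integral>\<^sup>+\<omega>. indicator A (glue x \<omega>) * ennreal (?h (glue x \<omega>)) \<partial>?L)"
        by (intro nn_integral_cong) (auto simp: AB q_def n split: split_indicator)
      also have "\<dots> = (\<integral>\<^sup>+\<omega>. indicator A \<omega> * ennreal (?h \<omega>) \<partial>M)"
        unfolding M_def by (subst nn_integral_distr[OF gl]) (use A_U h_U in simp_all)
      finally have *: "(\<integral>\<^sup>+\<omega>. indicator A \<omega> * indicator {\<omega>. \<omega> j = a} \<omega> \<partial>M) =
          (\<integral>\<^sup>+\<omega>. indicator A \<omega> * ennreal (?h \<omega>) \<partial>M)" .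
      have "(LINT \<omega>:A|M. indicator {\<omega>. \<omega> j = a} \<omega>) =
          enn2real (\<integral>\<^sup>+\<omega>. indicator A \<omega> * indicator {\<omega>. \<omega> j = a} \<omega> \<partial>M)"
        unfolding set_lebesgue_integral_def
        by (subst integral_eq_nn_integral)
           (auto intro!: arg_cong[where f = enn2real] nn_integral_cong split: split_indicator)
      also have "\<dots> = (LINT \<omega>:A|M. ?h \<omega>)"
        unfolding set_lebesgue_integral_def *
        by (subst integral_eq_nn_integral)
           (auto intro!: arg_cong[where f = enn2real] nn_integral_cong simp: h01 split: split_indicator)
      finally show "(LINT \<omega>:A|M. indicator {\<omega>. \<omega> j = a} \<omega>) = (LINT \<omega>:A|M. ?h \<omega>)" .
    next
      show "integrable M (indicator {\<omega>. \<omega> j = a} :: _ \<Rightarrow> real)"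
        by (rule integrable_real_indicator) (auto simp: less_top[symmetric])
      show "integrable M ?h"
        by (rule M.integrable_const_bound[of _ 1]) (auto simp: h01)
      show "?h \<in> borel_measurable ?F" by (rule h_F)
    qed
  qed
  ultimately have "forward_law g x M"
    using M.prob_space_axioms by (simp add: forward_law_def sets_M space_M)
  then show ?thesis ..
qed

end

theory Submission
  imports Defs
begin

text \<open>Square summability of the variation bounds the second moment of the likelihood ratio of the
  futures started from two pasts, uniformly over the pasts and the length of the future. By
  Cauchy--Schwarz, \<open>P[A | w]\<^sup>2 \<le> C * Q[A | w']\<close> whenever \<open>w\<close>, \<open>w'\<close> are words on \<open>[0, k)\<close> and
  \<open>A\<close> is measurable with respect to the coordinates from \<open>k\<close> on. If a tail event \<open>A\<close> has
  \<open>P[A] > 0\<close>, approximating it by cylinders gives arbitrarily long words \<open>w\<close> with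
  \<open>P[A | w] > 1/2\<close>, hence \<open>Q[A | w'] \<ge> 1/(4C)\<close> for all long words \<open>w'\<close>; approximating the complement of
  \<open>A\<close> by cylinders then gives \<open>Q[A] = 1\<close>.\<close>

section \<open>Approximation by an algebra\<close>

text \<open>The sets that can be approximated contain \<open>G\<close> and are closed under
  complement and countable union, which is an induction over \<open>sigma_sets\<close>. The
  approximation is made for two measures at once, because the comparison of two laws needs a single
  sequence of cylinders that converges under both.\<close>

lemma sigma_sets_approx:
  assumes "algebra \<Omega> G" "A \<in> sigma_sets \<Omega> G"
    and "finite_measure M" "finite_measure N"
    and "sigma_sets \<Omega> G \<subseteq> sets M" "sigma_sets \<Omega> G \<subseteq> sets N" "(e::real) > 0"
  shows "\<exists>B\<in>G. measure M (sym_diff A B) + measure N (sym_diff A B) < e"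
  using assms(2,7)
proof (induction arbitrary: e rule: sigma_sets.induct)
  interpret G: algebra \<Omega> G by fact
  interpret M: finite_measure M by fact
  interpret N: finite_measure N by fact
  {
    case (Basic a)
    then show ?case by (intro bexI[of _ a]) auto
  next
    case Empty
    then show ?case by (intro bexI[of _ "{}"]) auto
  next
    case (Compl a)
    then obtain B where B: "B \<in> G" "measure M (sym_diff a B) + measure N (sym_diff a B) < e" by blast
    have "a \<subseteq> \<Omega>" using Compl.hyps G.space_closed by (rule sigma_sets_into_sp[rotated])
    moreover have "B \<subseteq> \<Omega>" using B(1) G.space_closed by auto
    ultimately have "sym_diff (\<Omega> - a) (\<Omega> - B) = sym_diff a B" by auto
    then show ?case using B by (intro bexI[of _ "\<Omega> - B"]) auto
  next
    case (Union a)
    let ?U = "\<lambda>n. \<Union>i<n. a i"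
    let ?V = "\<Union>i. a i"
    have aM: "a i \<in> sets M" "a i \<in> sets N" for i using Union.hyps assms(5,6) by auto
    \<comment> \<open>A countable union is first cut down to a finite one: what is left out
      decreases to the empty set, so it has small mass under both measures.\<close>
    have "(\<lambda>n. measure M (?V - ?U n) + measure N (?V - ?U n))
        \<longlonglongrightarrow> measure M (\<Inter>n. ?V - ?U n) + measure N (\<Inter>n. ?V - ?U n)"
      by (intro tendsto_add M.finite_Lim_measure_decseq N.finite_Lim_measure_decseq)
        (auto simp: decseq_def aM intro!: sets.Diff sets.countable_UN intro: less_le_trans)
    moreover have empty: "(\<Inter>n. ?V - ?U n) = {}" by auto
    ultimately have "(\<lambda>n. measure M (?V - ?U n) + measure N (?V - ?U n)) \<longlonglongrightarrow> 0"
      unfolding empty by (simp only: measure_empty add_0)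
    then have "\<forall>\<^sub>F n in sequentially. measure M (?V - ?U n) + measure N (?V - ?U n) < e / 2"
      using Union.prems by (intro order_tendstoD(2)[of _ 0]) auto
    from eventually_happens'[OF sequentially_bot this]
    obtain n where n: "measure M (?V - ?U n) + measure N (?V - ?U n) < e / 2" by (rule exE)
    \<comment> \<open>The \<open>n\<close> errors of size \<open>d\<close> add up to at most
      \<open>e / 2\<close>; the \<open>+ 1\<close> covers the case \<open>n = 0\<close>.\<close>
    define d where "d = e / 2 / (real n + 1)"
    have "d > 0" using Union.prems by (simp add: d_def)
    then have "\<forall>i. \<exists>B\<in>G. measure M (sym_diff (a i) B) + measure N (sym_diff (a i) B) < d"
      using Union.IH by blast
    then obtain B where B: "\<And>i. B i \<in> G"
      "\<And>i. measure M (sym_diff (a i) (B i)) + measure N (sym_diff (a i) (B i)) < d" by metis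
    have BM: "B i \<in> sets M" "B i \<in> sets N" for i using B(1) assms(5,6) by auto
    let ?B = "\<Union>i<n. B i"
    have sub: "sym_diff ?V ?B \<subseteq> (?V - ?U n) \<union> (\<Union>i<n. sym_diff (a i) (B i))" by auto
    have bound: "measure L (sym_diff ?V ?B)
        \<le> measure L (?V - ?U n) + (\<Sum>i<n. measure L (sym_diff (a i) (B i)))"
      if "finite_measure L" and L: "\<And>i. a i \<in> sets L" "\<And>i. B i \<in> sets L" for L
    proof -
      interpret L: finite_measure L by fact
      have S: "?V - ?U n \<in> sets L" "(\<Union>i<n. sym_diff (a i) (B i)) \<in> sets L"
        using L by (intro sets.Diff sets.Un sets.countable_UN sets.finite_UN; blast)+
      have "measure L (sym_diff ?V ?B) \<le> measure L ((?V - ?U n) \<union> (\<Union>i<n. sym_diff (a i) (B i)))"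
        by (intro L.finite_measure_mono sub sets.Un S)
      also have "\<dots> \<le> measure L (?V - ?U n) + measure L (\<Union>i<n. sym_diff (a i) (B i))"
        by (intro measure_Un_le S)
      also have "measure L (\<Union>i<n. sym_diff (a i) (B i)) \<le> (\<Sum>i<n. measure L (sym_diff (a i) (B i)))"
        using L by (intro L.finite_measure_subadditive_finite) auto
      finally show ?thesis by simp
    qed
    have "measure M (sym_diff ?V ?B) \<le> measure M (?V - ?U n) + (\<Sum>i<n. measure M (sym_diff (a i) (B i)))"
      "measure N (sym_diff ?V ?B) \<le> measure N (?V - ?U n) + (\<Sum>i<n. measure N (sym_diff (a i) (B i)))"
      by (rule bound; fact)+
    moreover have "(\<Sum>i<n. measure M (sym_diff (a i) (B i)) + measure N (sym_diff (a i) (B i))) \<le> (\<Sum>i<n. d)"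
      by (intro sum_mono less_imp_le B(2))
    moreover have "(\<Sum>i<n. d) \<le> e / 2"
      using Union.prems by (simp add: d_def field_simps)
    ultimately have "measure M (sym_diff ?V ?B) + measure N (sym_diff ?V ?B) < e"
      using n unfolding sum.distrib by linarith
    then show ?case using B(1) by (intro bexI[of _ ?B]) auto
  }
qed

section \<open>Words\<close>

text \<open>Words are read like pasts, the most recent letter first.\<close>

definition word_at :: "int \<Rightarrow> nat \<Rightarrow> (int \<Rightarrow> 's) \<Rightarrow> 's list" where
  "word_at k m \<omega> = map (\<lambda>i. \<omega> (k + int m - 1 - int i)) [0..<m]"

lemma word_at_Suc: "word_at k (Suc m) \<omega> = \<omega> (k + int m) # word_at k m \<omega>"
  unfolding word_at_def by (rule nth_equalityI) (auto simp: nth_Cons algebra_simps simp del: upt_Suc split: nat.split)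

lemma word_at_0 [simp]: "word_at k 0 \<omega> = []"
  by (simp add: word_at_def)

lemma length_word_at [simp]: "length (word_at k m \<omega>) = m"
  by (simp add: word_at_def)

lemma word_at_add: "word_at k (m + j) \<omega> = word_at (k + int m) j \<omega> @ word_at k m \<omega>"
  by (induction j) (auto simp: word_at_Suc algebra_simps)

text \<open>Only the left end \<open>k\<close> is fixed, so two cylinders can be brought to a common
  length. Elements of \<open>V\<close> of length other than \<open>m\<close> never occur as values
  of \<open>word_at k m\<close>; sums over \<open>V\<close> therefore run over
  \<open>V \<inter> {v. length v = m}\<close>, which is finite.\<close>

definition cylinders :: "int \<Rightarrow> (int \<Rightarrow> 's) set set" where
  "cylinders k = {{\<omega>. word_at k m \<omega> \<in> V} | m V. True}"

lemma cylindersI: "{\<omega>. word_at k m \<omega> \<in> V} \<in> cylinders k"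
  by (auto simp: cylinders_def)

text \<open>Later letters stand in front of the list, so \<open>drop j\<close> recovers the shorter
  word. This allows any cylinder to be treated as one of arbitrarily large length.\<close>

lemma cylinder_extend: "{\<omega>. word_at k m \<omega> \<in> V} = {\<omega>. word_at k (m + j) \<omega> \<in> {v. drop j v \<in> V}}"
  by (simp add: word_at_add)

lemma algebra_cylinders: "algebra UNIV (cylinders k :: (int \<Rightarrow> 's) set set)"
  unfolding algebra_iff_Un
proof (intro conjI ballI)
  show "{} \<in> cylinders k" unfolding cylinders_def by (force intro: exI[of _ "{}"])
next
  fix a :: "(int \<Rightarrow> 's) set" assume "a \<in> cylinders k"
  then obtain m V where "a = {\<omega>. word_at k m \<omega> \<in> V}" by (auto simp: cylinders_def)
  then have "UNIV - a = {\<omega>. word_at k m \<omega> \<in> - V}" by auto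
  then show "UNIV - a \<in> cylinders k" using cylindersI[of k m "- V"] by simp
next
  fix a b :: "(int \<Rightarrow> 's) set" assume "a \<in> cylinders k" "b \<in> cylinders k"
  then obtain m V n W where "a = {\<omega>. word_at k m \<omega> \<in> V}" "b = {\<omega>. word_at k n \<omega> \<in> W}"
    by (auto simp: cylinders_def)
  then have "a \<union> b = {\<omega>. word_at k (m + n) \<omega> \<in> {v. drop n v \<in> V} \<union> {v. drop m v \<in> W}}"
    using cylinder_extend[of k m V n] cylinder_extend[of k n W m] by (auto simp: add.commute)
  then show "a \<union> b \<in> cylinders k" by (simp only: cylindersI)
qed auto

lemma measurable_word_at:
  fixes I :: "int set"
  assumes "{k..<k + int m} \<subseteq> I"
  shows "word_at k m \<in> measurable (coord_algebra I :: (int \<Rightarrow> 's::finite) measure) (count_space UNIV)"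
proof (subst measurable_count_space_eq2_countable, intro conjI ballI)
  fix v :: "'s list"
  have "{\<omega>. word_at k m \<omega> = v} \<in> sets (coord_algebra I)"
    using assms
  proof (induction m arbitrary: v)
    case 0
    show ?case using sets.top[of "coord_algebra I"] by (cases "v = []") auto
  next
    case (Suc m)
    show ?case
    proof (cases v)
      case Nil then show ?thesis by (simp add: word_at_Suc)
    next
      case (Cons a u)
      have "(\<lambda>\<omega>. \<omega> (k + int m)) -` {a} \<inter> space (coord_algebra I) \<in> sets (coord_algebra I)"
        by (rule measurable_sets[OF measurable_coord]) (use Suc.prems in auto)
      moreover have "{k..<k + int m} \<subseteq> I" using Suc.prems by auto
      ultimately have "{\<omega>. \<omega> (k + int m) = a} \<inter> {\<omega>. word_at k m \<omega> = u} \<in> sets (coord_algebra I)"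
        by (intro sets.Int Suc.IH) (simp_all add: vimage_def)
      then show ?thesis by (simp add: Cons word_at_Suc Collect_conj_eq)
    qed
  qed
  then show "word_at k m -` {v} \<inter> space (coord_algebra I) \<in> sets (coord_algebra I)"
    by (simp add: vimage_def)
qed (auto intro: countableI_type)

lemma cylinder_sets:
  assumes "{k..<k + int m} \<subseteq> I"
  shows "{\<omega> :: int \<Rightarrow> 's::finite. word_at k m \<omega> \<in> V} \<in> sets (coord_algebra I)"
  using measurable_sets[OF measurable_word_at[OF assms], of V] by (simp add: vimage_def)

lemma sigma_sets_cylinders:
  "sigma_sets UNIV (cylinders k) = sets (coord_algebra {k..} :: (int \<Rightarrow> 's::finite) measure)"
proof
  show "sigma_sets UNIV (cylinders k) \<subseteq> sets (coord_algebra {k..} :: (int \<Rightarrow> 's) measure)"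
  proof -
    have "cylinders k \<subseteq> sets (coord_algebra {k..} :: (int \<Rightarrow> 's) measure)"
      by (auto simp: cylinders_def intro!: cylinder_sets)
    from sets.sigma_sets_subset[OF this] show ?thesis by simp
  qed
  show "sets (coord_algebra {k..} :: (int \<Rightarrow> 's) measure) \<subseteq> sigma_sets UNIV (cylinders k)"
    unfolding sets_coord_algebra
  proof (rule sigma_sets_mono, safe)
    fix i :: int and B :: "'s set" assume "k \<le> i"
    \<comment> \<open>Coordinate \<open>i\<close> is the newest letter of the word on [k, i], hence
      its head.\<close>
    then have "(\<lambda>\<omega>. \<omega> i) -` B = {\<omega>. word_at k (Suc (nat (i - k))) \<omega> \<in> {v. hd v \<in> B}}"
      by (simp add: word_at_Suc vimage_def)
    then show "(\<lambda>\<omega>. \<omega> i) -` B \<in> sigma_sets UNIV (cylinders k)"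
      by (simp only: cylindersI sigma_sets.Basic)
  qed
qed

lemma measure_Int_cylinder:
  fixes M :: "(int \<Rightarrow> 's::finite) measure"
  assumes "finite_measure M" "sets M = sets (coord_algebra UNIV)" "A \<in> sets M"
  shows "measure M (A \<inter> {\<omega>. word_at k m \<omega> \<in> V})
    = (\<Sum>v\<in>V \<inter> {v. length v = m}. measure M (A \<inter> {\<omega>. word_at k m \<omega> = v}))"
proof -
  interpret finite_measure M by fact
  have cyl: "{\<omega>. word_at k m \<omega> = v} \<in> sets M" for v
    using cylinder_sets[of k m UNIV "{v}"] assms(2) by simp
  have fin: "finite {v :: 's list. length v = m}"
    using finite_lists_length_eq[of "UNIV :: 's set" m] by simp
  have "A \<inter> {\<omega>. word_at k m \<omega> \<in> V} = (\<Union>v\<in>V \<inter> {v. length v = m}. A \<inter> {\<omega>. word_at k m \<omega> = v})"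
    by auto
  also have "measure M \<dots> = (\<Sum>v\<in>V \<inter> {v. length v = m}. measure M (A \<inter> {\<omega>. word_at k m \<omega> = v}))"
    by (rule finite_measure_finite_Union) (use fin cyl assms(3) in \<open>auto simp: disjoint_family_on_def\<close>)
  finally show ?thesis .
qed

section \<open>Word probabilities\<close>

definition extend_past :: "'s list \<Rightarrow> 's past \<Rightarrow> 's past" where
  "extend_past v x = comb_seq (length v) ((!) v) x"

text \<open>The chain rule product for the probability that the process started from the past
  \<open>x\<close> begins with \<open>v\<close>; the recursion splits off the newest letter, whose
  conditional law depends on the older ones and on \<open>x\<close>.\<close>

primrec word_prob :: "('s::finite \<Rightarrow> 's past \<Rightarrow> real) \<Rightarrow> 's past \<Rightarrow> 's list \<Rightarrow> real" where
  "word_prob g x [] = 1"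
| "word_prob g x (a # v) = g a (extend_past v x) * word_prob g x v"

lemma extend_past_append: "extend_past (v @ w) x = extend_past v (extend_past w x)"
  by (rule ext) (auto simp: extend_past_def comb_seq_def nth_append algebra_simps)

lemma word_prob_append: "word_prob g x (v @ w) = word_prob g (extend_past w x) v * word_prob g x w"
  by (induction v) (auto simp: extend_past_append)

lemma word_prob_pos:
  assumes "\<And>a x. 0 < g a x" shows "0 < word_prob g x v"
  by (induction v) (auto simp: assms)

lemma sum_length_Suc:
  "(\<Sum>v | length v = Suc m. f v) = (\<Sum>v | length v = m. \<Sum>a\<in>(UNIV :: 's::finite set). f (a # v))"
proof -
  have "{v :: 's list. length v = Suc m} = (\<lambda>(v, a). a # v) ` ({v. length v = m} \<times> UNIV)"
    by (auto simp: length_Suc_conv)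
  then have "(\<Sum>v | length v = Suc m. f v) = (\<Sum>(v, a)\<in>{v. length v = m} \<times> (UNIV :: 's set). f (a # v))"
    by (simp add: sum.reindex inj_on_def split_beta)
  then show ?thesis by (simp add: sum.cartesian_product)
qed

text \<open>The two pasts share their last \<open>length v\<close> letters, so the difference is a
  member of the family in \<open>var\<close>. That family is bounded because a kernel takes values
  in [0, 1], so its real supremum is an upper bound.\<close>

lemma kernel_diff_le_var:
  assumes "kernel g"
  shows "\<bar>g a (extend_past v x) - g a (extend_past v y)\<bar> \<le> var (length v) g"
proof -
  let ?f = "\<lambda>(a, w, x, y). \<bar>g a (comb_seq (length v) w x) - g a (comb_seq (length v) w y)\<bar>"
  have "\<bar>g a z - g a z'\<bar> \<le> 1" for a z z'
    using assms unfolding kernel_def by (smt (verit))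
  then have "bdd_above (range ?f)" by (intro bdd_aboveI[of _ 1]) auto
  from cSUP_upper[OF _ this, of "(a, (!) v, x, y)"] show ?thesis
    by (simp add: var_def extend_past_def)
qed

text \<open>Expanding around \<open>q\<close> gives p^2/q = 2p - q + (p - q)^2/q. The linear part
  sums to 1 and each remaining term is at most d^2/c. The excess over 1 is thus quadratic in
  \<open>d\<close>, which is why square summability suffices.\<close>

lemma chi_square_le:
  fixes p q :: "'s::finite \<Rightarrow> real"
  assumes "c > 0" "\<And>a. c \<le> q a" "\<And>a. \<bar>p a - q a\<bar> \<le> d" "sum p UNIV = 1" "sum q UNIV = 1"
  shows "(\<Sum>a\<in>UNIV. (p a)\<^sup>2 / q a) \<le> 1 + CARD('s) / c * d\<^sup>2"
proof -
  have q: "q a > 0" for a using assms(1,2) by (rule less_le_trans)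
  have "(p a)\<^sup>2 / q a = 2 * p a - q a + (p a - q a)\<^sup>2 / q a" for a
    using q[of a] by (simp add: field_simps power2_eq_square)
  then have "(\<Sum>a\<in>UNIV. (p a)\<^sup>2 / q a) = 1 + (\<Sum>a\<in>UNIV. (p a - q a)\<^sup>2 / q a)"
    by (simp add: sum.distrib sum_subtractf sum_distrib_left[symmetric] assms(4,5))
  also have "(\<Sum>a\<in>UNIV. (p a - q a)\<^sup>2 / q a) \<le> (\<Sum>a\<in>(UNIV::'s set). d\<^sup>2 / c)"
  proof (rule sum_mono)
    fix a
    have "(p a - q a)\<^sup>2 \<le> d\<^sup>2" using assms(3)[of a] by (simp add: abs_le_square_iff[symmetric])
    then show "(p a - q a)\<^sup>2 / q a \<le> d\<^sup>2 / c" using assms(1,2) by (intro frac_le) auto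
  qed
  finally show ?thesis by simp
qed

text \<open>Induction on the length, splitting off the newest letter. After the same word of length
  \<open>m\<close>, the two conditional laws of the next letter differ by at most
  \<open>var m g\<close>, so \<open>chi_square_le\<close> contributes a factor that depends neither
  on the word nor on the two pasts.\<close>

lemma word_prob_second_moment:
  fixes g :: "'s::finite \<Rightarrow> 's past \<Rightarrow> real"
  assumes "kernel g" "c > 0" "\<And>a x. c \<le> g a x"
  shows "(\<Sum>v | length v = m. (word_prob g x v)\<^sup>2 / word_prob g y v)
    \<le> exp (CARD('s) / c * (\<Sum>k<m. (var k g)\<^sup>2))"
proof (induction m)
  case 0
  then show ?case by simp
next
  case (Suc m)
  have g: "0 < g a x" for a x using assms(2,3) by (rule less_le_trans)
  let ?r = "\<lambda>v. (word_prob g x v)\<^sup>2 / word_prob g y v"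
  let ?e = "CARD('s) / c * (var m g)\<^sup>2"
  have "(\<Sum>v | length v = Suc m. ?r v)
      = (\<Sum>v | length v = m. ?r v * (\<Sum>a\<in>UNIV. (g a (extend_past v x))\<^sup>2 / g a (extend_past v y)))"
    unfolding sum_length_Suc sum_distrib_left
    by (intro sum.cong refl) (simp add: power_mult_distrib mult.commute)
  also have "\<dots> \<le> (\<Sum>v | length v = m. ?r v * (1 + ?e))"
  proof (intro sum_mono mult_left_mono)
    fix v :: "'s list" assume "v \<in> {v. length v = m}"
    then show "(\<Sum>a\<in>UNIV. (g a (extend_past v x))\<^sup>2 / g a (extend_past v y)) \<le> 1 + ?e"
      using assms kernel_diff_le_var[OF assms(1), of _ v x y]
      by (intro chi_square_le) (auto simp: kernel_def)
    show "0 \<le> ?r v" using word_prob_pos[of g y v] g by simp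
  qed
  \<comment> \<open>The new factor is absorbed by 1 + t <= exp t.\<close>
  also have "\<dots> \<le> exp (CARD('s) / c * (\<Sum>k<m. (var k g)\<^sup>2)) * exp ?e"
    unfolding sum_distrib_right[symmetric]
    using assms(2) by (intro mult_mono Suc) auto
  also have "\<dots> = exp (CARD('s) / c * (\<Sum>k<Suc m. (var k g)\<^sup>2))"
    by (simp add: exp_add[symmetric] algebra_simps)
  finally show ?case .
qed

text \<open>Cauchy-Schwarz for p = (p / sqrt q) * sqrt q, where the first factor produces the second
  moment. The constant depends on none of \<open>V\<close>, \<open>m\<close>, \<open>x\<close> and
  \<open>y\<close>, so it survives both a change of pasts and the limit over cylinders.\<close>

lemma word_prob_sum_comparison:
  fixes g :: "'s::finite \<Rightarrow> 's past \<Rightarrow> real"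
  assumes "kernel g" "c > 0" "\<And>a x. c \<le> g a x" "summable (\<lambda>k. (var k g)\<^sup>2)"
  shows "(\<Sum>v\<in>V \<inter> {v. length v = m}. word_prob g x v)\<^sup>2
    \<le> exp (CARD('s) / c * (\<Sum>k. (var k g)\<^sup>2)) * (\<Sum>v\<in>V \<inter> {v. length v = m}. word_prob g y v)"
proof -
  let ?p = "word_prob g x" and ?q = "word_prob g y" and ?W = "V \<inter> {v. length v = m}"
  have g: "0 < g a x" for a x using assms(2,3) by (rule less_le_trans)
  have q: "0 < ?q v" for v by (rule word_prob_pos[OF g])
  have fin: "finite {v :: 's list. length v = m}"
    using finite_lists_length_eq[of "UNIV :: 's set" m] by simp
  have "(\<Sum>v\<in>?W. ?p v) = (\<Sum>v\<in>?W. (?p v / sqrt (?q v)) * sqrt (?q v))"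
    using q by (intro sum.cong) (auto simp: less_imp_neq[THEN not_sym])
  also have "\<dots>\<^sup>2 \<le> (\<Sum>v\<in>?W. (?p v / sqrt (?q v))\<^sup>2) * (\<Sum>v\<in>?W. (sqrt (?q v))\<^sup>2)"
    by (rule Cauchy_Schwarz_ineq_sum)
  also have "\<dots> = (\<Sum>v\<in>?W. (?p v)\<^sup>2 / ?q v) * (\<Sum>v\<in>?W. ?q v)"
    using q by (simp add: power_divide less_imp_le)
  also have "(\<Sum>v\<in>?W. (?p v)\<^sup>2 / ?q v) \<le> (\<Sum>v | length v = m. (?p v)\<^sup>2 / ?q v)"
    by (intro sum_mono2 fin) (auto simp: q less_imp_le)
  also have "\<dots> \<le> exp (CARD('s) / c * (\<Sum>k<m. (var k g)\<^sup>2))"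
    by (rule word_prob_second_moment[OF assms(1-3)])
  also have "\<dots> \<le> exp (CARD('s) / c * (\<Sum>k. (var k g)\<^sup>2))"
    using assms(2) sum_le_suminf[OF assms(4), of "{..<m}"]
    by (intro iffD2[OF exp_le_cancel_iff] mult_left_mono) auto
  finally show ?thesis using q by (simp add: mult_right_mono sum_nonneg less_imp_le)
qed

section \<open>Forward laws\<close>

lemma past_at_eq_extend_past:
  "past_at (int n) \<omega> = extend_past (word_at 0 n \<omega>) (past_at 0 \<omega>)"
  by (rule ext) (auto simp: past_at_def extend_past_def comb_seq_def word_at_def not_less
      intro!: arg_cong[where f = \<omega>])

lemma forward_law_word:
  fixes g :: "'s::finite \<Rightarrow> 's past \<Rightarrow> real"
  assumes "forward_law g x M"
  shows "measure M {\<omega>. word_at 0 n \<omega> = v} = (if length v = n then word_prob g x v else 0)"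
proof -
  interpret prob_space M using assms by (simp add: forward_law_def)
  have M: "space M = UNIV" "sets M = sets (coord_algebra UNIV)" "AE \<omega> in M. past_at 0 \<omega> = x"
    using assms by (auto simp: forward_law_def)
  have "measure M {\<omega>. word_at 0 (length v) \<omega> = v} = word_prob g x v"
  proof (induction v)
    case Nil
    then show ?case using prob_space by (simp add: M)
  next
    case (Cons a v)
    define n where "n = length v"
    let ?F = "coord_algebra {..int n - 1} :: (int \<Rightarrow> 's) measure"
    let ?J = "{\<omega> :: int \<Rightarrow> 's. \<omega> (int n) = a}" and ?A = "{\<omega> :: int \<Rightarrow> 's. word_at 0 n \<omega> = v}"
    have subF: "sets ?F \<subseteq> sets M" unfolding M by (rule sets_coord_algebra_mono) simp
    interpret F: finite_measure_subalgebra M ?F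
      by unfold_locales (use subF in \<open>auto simp: subalgebra_def M(1)\<close>)
    have "{0..<0 + int n} \<subseteq> {..int n - 1}" by auto
    from cylinder_sets[OF this, of "{v}"] have A_F: "?A \<in> sets ?F" by simp
    have A [measurable]: "?A \<in> sets M" using A_F subF by auto
    have J [measurable]: "?J \<in> sets M"
      using measurable_sets[OF measurable_coord[of "int n" UNIV], of "{a}"] by (simp add: vimage_def M)
    have "measure M {\<omega>. word_at 0 (length (a # v)) \<omega> = a # v} = measure M (?A \<inter> ?J)"
      by (intro arg_cong[where f = "measure M"]) (auto simp: word_at_Suc n_def)
    also have "\<dots> = (LINT \<omega>:?A|M. indicator ?J \<omega>)"
      by (simp add: set_lebesgue_integral_def indicator_inter_arith[symmetric] Int_absorb2 M)
    \<comment> \<open>The event \<open>?A\<close> is determined by the coordinates before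
      \<open>n\<close>, so the indicator may be replaced by its conditional expectation on
      it.\<close>
    also have "\<dots> = (LINT \<omega>:?A|M. real_cond_exp M ?F (indicator ?J) \<omega>)"
      by (rule F.real_cond_exp_intA) (auto simp: A_F intro!: integrable_real_indicator simp: less_top[symmetric])
    \<comment> \<open>On \<open>?A\<close>, almost every path has the past
      \<open>extend_past v x\<close> at time \<open>n\<close>, so the conditional probability is
      constant there.\<close>
    also have "\<dots> = (LINT \<omega>:?A|M. g a (extend_past v x))"
    proof (rule set_lebesgue_integral_cong_AE)
      have "AE \<omega> in M. real_cond_exp M ?F (indicator ?J) \<omega> = g a (past_at (int n) \<omega>)"
        using assms by (simp add: forward_law_def)
      with M(3) show "AE \<omega>\<in>?A in M. real_cond_exp M ?F (indicator ?J) \<omega> = g a (extend_past v x)"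
        by eventually_elim (simp add: past_at_eq_extend_past)
    qed auto
    also have "\<dots> = word_prob g x (a # v)"
      using Cons by (simp add: set_lebesgue_integral_def n_def M(1))
    finally show ?case .
  qed
  note word = this
  show ?thesis
  proof (cases "length v = n")
    case True
    then show ?thesis using word by simp
  next
    case False
    then have "word_at 0 n \<omega> \<noteq> v" for \<omega> using length_word_at by blast
    then have "{\<omega>. word_at 0 n \<omega> = v} = {}" by blast
    then show ?thesis using False by (simp only: measure_empty if_False)
  qed
qed

text \<open>Once \<open>w\<close> has been seen, the process restarts from the past
  \<open>extend_past w x\<close>. The later word stands in front of \<open>w\<close> in the list,
  and \<open>word_prob_append\<close> factorises.\<close>

lemma forward_law_Int_words:
  fixes g :: "'s::finite \<Rightarrow> 's past \<Rightarrow> real"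
  assumes "forward_law g x M" "length w = k"
  shows "measure M ({\<omega>. word_at 0 k \<omega> = w} \<inter> {\<omega>. word_at (int k) m \<omega> \<in> V})
    = word_prob g x w * (\<Sum>v\<in>V \<inter> {v. length v = m}. word_prob g (extend_past w x) v)"
proof -
  interpret prob_space M using assms by (simp add: forward_law_def)
  have M: "sets M = sets (coord_algebra UNIV)" using assms by (auto simp: forward_law_def)
  have w: "{\<omega>. word_at 0 k \<omega> = w} \<in> sets M"
    using cylinder_sets[of 0 k UNIV "{w}"] M by simp
  have "measure M ({\<omega>. word_at 0 k \<omega> = w} \<inter> {\<omega>. word_at (int k) m \<omega> = v})
      = word_prob g x w * word_prob g (extend_past w x) v" if "length v = m" for v
  proof -
    have "{\<omega>. word_at 0 k \<omega> = w} \<inter> {\<omega>. word_at (int k) m \<omega> = v} = {\<omega>. word_at 0 (k + m) \<omega> = v @ w}"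
      using that by (auto simp: word_at_add)
    then show ?thesis using that assms(2)
      by (simp add: forward_law_word[OF assms(1)] word_prob_append)
  qed
  then show ?thesis
    by (simp add: measure_Int_cylinder[OF finite_measure_axioms M w] sum_distrib_left)
qed

text \<open>This is \<open>M[A | w]\<close>^2 <= C \<open>N[A | w']\<close> with the denominators
  cleared. For a cylinder it is \<open>word_prob_sum_comparison\<close> applied to the pasts
  \<open>extend_past w x\<close> and \<open>extend_past w' y\<close>; the general case follows by a
  limit, as both sides depend continuously on the measures of the intersections.\<close>

lemma forward_law_comparison:
  fixes g :: "'s::finite \<Rightarrow> 's past \<Rightarrow> real"
  assumes "kernel g" "c > 0" "\<And>a x. c \<le> g a x" "summable (\<lambda>k. (var k g)\<^sup>2)"
    and M: "forward_law g x M" and N: "forward_law g y N"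
    and w: "length w = k" "length w' = k"
    and A: "A \<in> sets (coord_algebra {int k..})"
  shows "(measure M ({\<omega>. word_at 0 k \<omega> = w} \<inter> A))\<^sup>2 * word_prob g y w'
    \<le> exp (CARD('s) / c * (\<Sum>k. (var k g)\<^sup>2)) * measure N ({\<omega>. word_at 0 k \<omega> = w'} \<inter> A)
      * (word_prob g x w)\<^sup>2"
proof -
  let ?C = "exp (CARD('s) / c * (\<Sum>k. (var k g)\<^sup>2))"
  let ?W = "{\<omega>. word_at 0 k \<omega> = w}" and ?W' = "{\<omega>. word_at 0 k \<omega> = w'}"
  interpret M: prob_space M using M by (simp add: forward_law_def)
  interpret N: prob_space N using N by (simp add: forward_law_def)
  have sets: "sets M = sets (coord_algebra UNIV)" "sets N = sets (coord_algebra UNIV)"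
    using M N by (auto simp: forward_law_def)
  have sub: "sets (coord_algebra {j..}) \<subseteq> sets M" "sets (coord_algebra {j..}) \<subseteq> sets N" for j
    unfolding sets by (auto intro!: sets_coord_algebra_mono)
  have W: "?W \<in> sets M" "?W' \<in> sets N"
    using cylinder_sets[of 0 k UNIV "{w}"] cylinder_sets[of 0 k UNIV "{w'}"] sets by simp_all
  have g: "0 < g a x" for a x using assms(2,3) by (rule less_le_trans)
  have "\<exists>B\<in>cylinders (int k). measure M (sym_diff A B) + measure N (sym_diff A B) < e" if "e > 0" for e
    by (rule sigma_sets_approx[OF algebra_cylinders])
      (use A that sub in \<open>auto simp: sigma_sets_cylinders M.finite_measure_axioms N.finite_measure_axioms\<close>)
  then have "\<forall>n. \<exists>B\<in>cylinders (int k).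
      measure M (sym_diff A B) + measure N (sym_diff A B) < inverse (real (Suc n))"
    by (simp add: del: of_nat_Suc)
  then obtain B where B: "\<And>n. B n \<in> cylinders (int k)"
    "\<And>n. measure M (sym_diff A (B n)) + measure N (sym_diff A (B n)) < inverse (real (Suc n))"
    by metis
  have Bk: "B n \<in> sets (coord_algebra {int k..})" for n
    using B(1) by (metis sigma_sets.Basic sigma_sets_cylinders)
  \<comment> \<open>Intersecting with a fixed event \<open>U\<close> changes measures by no more
    than the symmetric difference, so the same cylinders serve for \<open>M\<close> with
    \<open>w\<close> and for \<open>N\<close> with \<open>w'\<close>.\<close>
  have conv: "(\<lambda>n. measure L (U \<inter> B n)) \<longlonglongrightarrow> measure L (U \<inter> A)"
    if L: "finite_measure L" "sets L = sets (coord_algebra UNIV)" "U \<in> sets L"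
      and le: "\<And>n. measure L (sym_diff A (B n)) < inverse (real (Suc n))" for L U
  proof -
    interpret L: finite_measure L by fact
    have AB [measurable]: "A \<in> sets L" "B n \<in> sets L" for n
      using A Bk sub unfolding L(2) sets by auto
    have "\<bar>measure L (U \<inter> B n) - measure L (U \<inter> A)\<bar> \<le> inverse (real (Suc n))" for n
    proof -
      have "measure L (U \<inter> B n) \<le> measure L ((U \<inter> A) \<union> sym_diff A (B n))"
        using L(3) by (intro L.finite_measure_mono) auto
      also have "\<dots> \<le> measure L (U \<inter> A) + measure L (sym_diff A (B n))"
        using L(3) by (intro measure_Un_le) auto
      finally have 1: "measure L (U \<inter> B n) \<le> measure L (U \<inter> A) + measure L (sym_diff A (B n))" .
      have "measure L (U \<inter> A) \<le> measure L ((U \<inter> B n) \<union> sym_diff A (B n))"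
        using L(3) by (intro L.finite_measure_mono) auto
      also have "\<dots> \<le> measure L (U \<inter> B n) + measure L (sym_diff A (B n))"
        using L(3) by (intro measure_Un_le) auto
      finally show ?thesis using 1 le[of n] by linarith
    qed
    then have "(\<lambda>n. measure L (U \<inter> B n) - measure L (U \<inter> A)) \<longlonglongrightarrow> 0"
      by (intro Lim_null_comparison[OF _ LIMSEQ_inverse_real_of_nat]) auto
    then show ?thesis by (rule LIM_zero_cancel)
  qed
  have M_lim: "(\<lambda>n. measure M (?W \<inter> B n)) \<longlonglongrightarrow> measure M (?W \<inter> A)"
    by (rule conv[OF M.finite_measure_axioms sets(1) W(1)])
      (use B(2) in \<open>smt (verit) measure_nonneg\<close>)
  have N_lim: "(\<lambda>n. measure N (?W' \<inter> B n)) \<longlonglongrightarrow> measure N (?W' \<inter> A)"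
    by (rule conv[OF N.finite_measure_axioms sets(2) W(2)])
      (use B(2) in \<open>smt (verit) measure_nonneg\<close>)
  show ?thesis
  proof (rule LIMSEQ_le)
    show "(\<lambda>n. (measure M (?W \<inter> B n))\<^sup>2 * word_prob g y w')
        \<longlonglongrightarrow> (measure M (?W \<inter> A))\<^sup>2 * word_prob g y w'"
      by (intro tendsto_intros M_lim)
    show "(\<lambda>n. ?C * measure N (?W' \<inter> B n) * (word_prob g x w)\<^sup>2)
        \<longlonglongrightarrow> ?C * measure N (?W' \<inter> A) * (word_prob g x w)\<^sup>2"
      by (intro tendsto_intros N_lim)
    have "(measure M (?W \<inter> B n))\<^sup>2 * word_prob g y w'
        \<le> ?C * measure N (?W' \<inter> B n) * (word_prob g x w)\<^sup>2" for n
    proof -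
      obtain m V where Bn: "B n = {\<omega>. word_at (int k) m \<omega> \<in> V}" using B(1)[of n] by (auto simp: cylinders_def)
      let ?p = "\<Sum>v\<in>V \<inter> {v. length v = m}. word_prob g (extend_past w x) v"
      let ?q = "\<Sum>v\<in>V \<inter> {v. length v = m}. word_prob g (extend_past w' y) v"
      have "?p\<^sup>2 * (word_prob g y w' * (word_prob g x w)\<^sup>2)
          \<le> ?C * ?q * (word_prob g y w' * (word_prob g x w)\<^sup>2)"
        by (intro mult_right_mono word_prob_sum_comparison assms(1-4))
          (simp add: word_prob_pos[OF g] less_imp_le)
      then show ?thesis
        unfolding Bn forward_law_Int_words[OF M w(1)] forward_law_Int_words[OF N w(2)]
        by (simp add: power_mult_distrib algebra_simps)
    qed
    then show "\<exists>n0. \<forall>n\<ge>n0. (measure M (?W \<inter> B n))\<^sup>2 * word_prob g y w'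
        \<le> ?C * measure N (?W' \<inter> B n) * (word_prob g x w)\<^sup>2" by blast
  qed
qed

section \<open>Tail events\<close>

lemma tail_event_coord_algebra:
  assumes "A \<in> tail_events"
  shows "A \<in> sets (coord_algebra {k..})"
proof -
  \<comment> \<open>The intersection defining \<open>tail_events\<close> starts at 1, so smaller
    \<open>k\<close> are reached by monotonicity.\<close>
  have "A \<in> sets (coord_algebra {max 1 k..})"
    using assms unfolding tail_events_def by (rule INT_D) simp
  moreover have "sets (coord_algebra {max 1 k..}) \<subseteq> sets (coord_algebra {k..})"
    by (rule sets_coord_algebra_mono) simp
  ultimately show ?thesis by (rule subsetD[rotated])
qed

lemma cylinder_approx:
  fixes M :: "(int \<Rightarrow> 's::finite) measure"
  assumes "finite_measure M" "sets M = sets (coord_algebra UNIV)" "A \<in> sets (coord_algebra {0..})" "e > 0"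
  obtains k V where "measure M (sym_diff A {\<omega>. word_at 0 k \<omega> \<in> V}) < e"
proof -
  have sub: "sigma_sets UNIV (cylinders 0) \<subseteq> sets M"
    unfolding sigma_sets_cylinders assms(2) by (intro sets_coord_algebra_mono) auto
  obtain B where B: "B \<in> cylinders 0" "measure M (sym_diff A B) + measure M (sym_diff A B) < e"
    using sigma_sets_approx[OF algebra_cylinders _ assms(1) assms(1) sub sub assms(4), of A] assms(3)
    by (auto simp: sigma_sets_cylinders)
  then have "measure M (sym_diff A B) < e" using measure_nonneg[of M "sym_diff A B"] by linarith
  then show ?thesis using B(1) that by (auto simp: cylinders_def)
qed

text \<open>Take a cylinder B with P(A sym_diff B) < P(A)/4. If \<open>A\<close> had conditional
  probability at most 1/2 given every word of length \<open>k\<close>, then P(A \<inter> B) <=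
  P(B)/2, that is P(A \<inter> B) <= P(B - A). Hence P(A) <= P(B - A) + P(A - B) < P(A)/2, a
  contradiction. Since B can be read at every length beyond its own, the argument covers all large
  \<open>k\<close>.\<close>

lemma tail_event_dense_word:
  fixes g :: "'s::finite \<Rightarrow> 's past \<Rightarrow> real"
  assumes M: "forward_law g x M" and A: "A \<in> tail_events" and pos: "measure M A > 0"
  shows "\<exists>k0. \<forall>k\<ge>k0. \<exists>w. length w = k \<and>
    word_prob g x w / 2 < measure M ({\<omega>. word_at 0 k \<omega> = w} \<inter> A)"
proof -
  interpret prob_space M using M by (simp add: forward_law_def)
  have sets: "sets M = sets (coord_algebra UNIV)" and space: "space M = UNIV"
    using M by (auto simp: forward_law_def)
  have cyl: "{\<omega>. word_at 0 k \<omega> \<in> V} \<in> sets M" for k V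
    using cylinder_sets[of 0 k UNIV V] sets by simp
  have A_M: "A \<in> sets M"
    using tail_event_coord_algebra[OF A, of 0] sets_coord_algebra_mono[of "{0..}" UNIV] unfolding sets by blast
  obtain k0 V where V: "measure M (sym_diff A {\<omega>. word_at 0 k0 \<omega> \<in> V}) < measure M A / 4"
    using cylinder_approx[OF finite_measure_axioms sets tail_event_coord_algebra[OF A], of "measure M A / 4"] pos
    by auto
  show ?thesis
  proof (rule exI[of _ k0], intro allI impI, rule ccontr)
    fix k assume "k \<ge> k0"
    then obtain j where k: "k = k0 + j" using le_Suc_ex by blast
    define V' where "V' = {v. drop j v \<in> V}"
    let ?B = "{\<omega>. word_at 0 k \<omega> \<in> V'}"
    have B: "?B = {\<omega>. word_at 0 k0 \<omega> \<in> V}"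
      unfolding V'_def k cylinder_extend[of 0 k0 V j, symmetric] ..
    assume "\<nexists>w. length w = k \<and> word_prob g x w / 2 < measure M ({\<omega>. word_at 0 k \<omega> = w} \<inter> A)"
    then have small: "measure M (A \<inter> {\<omega>. word_at 0 k \<omega> = w}) \<le> word_prob g x w / 2" if "length w = k" for w
      using that by (auto simp: not_less Int_commute)
    have "measure M (A \<inter> ?B) = (\<Sum>w\<in>V' \<inter> {w. length w = k}. measure M (A \<inter> {\<omega>. word_at 0 k \<omega> = w}))"
      by (rule measure_Int_cylinder[OF finite_measure_axioms sets A_M])
    also have "\<dots> \<le> (\<Sum>w\<in>V' \<inter> {w. length w = k}. word_prob g x w / 2)"
      by (intro sum_mono small) auto
    also have "\<dots> = measure M (space M \<inter> ?B) / 2"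
      unfolding measure_Int_cylinder[OF finite_measure_axioms sets sets.top]
      by (simp add: space forward_law_word[OF M] sum_divide_distrib)
    finally have half: "measure M (A \<inter> ?B) \<le> measure M ?B / 2" by (simp add: space)
    have "measure M A = measure M (A \<inter> ?B) + measure M (A - ?B)"
      using A_M cyl by (subst finite_measure_Union[symmetric]) (auto intro!: arg_cong[where f = "measure M"])
    moreover have "measure M ?B = measure M (A \<inter> ?B) + measure M (?B - A)"
      using A_M cyl by (subst finite_measure_Union[symmetric]) (auto intro!: arg_cong[where f = "measure M"])
    moreover have "measure M (A - ?B) \<le> measure M (sym_diff A ?B)" "measure M (?B - A) \<le> measure M (sym_diff A ?B)"
      by (intro finite_measure_mono Un_upper1 Un_upper2 sets.Un sets.Diff A_M cyl)+
    ultimately show False using half V pos unfolding B by linarith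
  qed
qed

text \<open>One word of each large length with density above 1/2 under \<open>M\<close> forces
  density at least \<open>\<delta>\<close> under \<open>N\<close> given every long word, hence given
  every cylinder. A cylinder close to the complement of \<open>A\<close> meets \<open>A\<close> in a
  set of small measure, so it is itself small, and the complement is null.\<close>

lemma tail_event_full:
  fixes g :: "'s::finite \<Rightarrow> 's past \<Rightarrow> real"
  assumes "kernel g" "c > 0" "\<And>a x. c \<le> g a x" "summable (\<lambda>k. (var k g)\<^sup>2)"
    and M: "forward_law g x M" and N: "forward_law g y N"
    and A: "A \<in> tail_events" and pos: "measure M A > 0"
  shows "measure N A = 1"
proof -
  let ?C = "exp (CARD('s) / c * (\<Sum>k. (var k g)\<^sup>2))"
  interpret N: prob_space N using N by (simp add: forward_law_def)
  have sets: "sets N = sets (coord_algebra UNIV)" and space: "space N = UNIV"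
    using N by (auto simp: forward_law_def)
  have cyl: "{\<omega>. word_at 0 k \<omega> \<in> V} \<in> sets N" for k V
    using cylinder_sets[of 0 k UNIV V] sets by simp
  have A_N: "A \<in> sets N"
    using tail_event_coord_algebra[OF A, of 0] sets_coord_algebra_mono[of "{0..}" UNIV] unfolding sets by blast
  have g: "0 < g a x" for a x using assms(2,3) by (rule less_le_trans)
  \<comment> \<open>The density 1/2 enters \<open>forward_law_comparison\<close> squared, which
    gives the 4; \<open>?C\<close> is the constant of that comparison.\<close>
  define \<delta> where "\<delta> = 1 / (4 * ?C)"
  have \<delta>: "\<delta> > 0" by (simp add: \<delta>_def)
  obtain k0 where k0: "\<And>k. k \<ge> k0 \<Longrightarrow> \<exists>w. length w = k \<and>
      word_prob g x w / 2 < measure M ({\<omega>. word_at 0 k \<omega> = w} \<inter> A)"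
    using tail_event_dense_word[OF M A pos] by blast
  have word: "\<delta> * word_prob g y w' \<le> measure N (A \<inter> {\<omega>. word_at 0 k \<omega> = w'})"
    if "k \<ge> k0" "length w' = k" for k w'
  proof -
    obtain w where w: "length w = k" "word_prob g x w / 2 < measure M ({\<omega>. word_at 0 k \<omega> = w} \<inter> A)"
      using k0 \<open>k \<ge> k0\<close> by blast
    let ?p = "word_prob g x w" and ?q = "word_prob g y w'"
      and ?n = "measure N ({\<omega>. word_at 0 k \<omega> = w'} \<inter> A)"
    have p: "?p > 0" "?q > 0" by (rule word_prob_pos[OF g])+
    have "(?p / 2)\<^sup>2 * ?q \<le> (measure M ({\<omega>. word_at 0 k \<omega> = w} \<inter> A))\<^sup>2 * ?q"
      using w(2) p by (intro mult_right_mono power_mono) auto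
    also have "\<dots> \<le> ?C * ?n * ?p\<^sup>2"
      by (rule forward_law_comparison[OF assms(1-4) M N w(1) that(2) tail_event_coord_algebra[OF A]])
    finally have "?p\<^sup>2 * (?q / 4) \<le> ?p\<^sup>2 * (?C * ?n)" by (simp add: power_divide algebra_simps)
    then have "?q / 4 \<le> ?C * ?n" using p by simp
    then show ?thesis by (simp add: \<delta>_def Int_commute field_simps)
  qed
  have dense: "\<delta> * measure N {\<omega>. word_at 0 k \<omega> \<in> V} \<le> measure N (A \<inter> {\<omega>. word_at 0 k \<omega> \<in> V})" for k V
  proof -
    \<comment> \<open>The bound \<open>word\<close> needs length at least \<open>k0\<close>, so the
      cylinder is rewritten with \<open>k0\<close> more letters.\<close>
    define V' where "V' = {v. drop k0 v \<in> V}"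
    have B: "{\<omega>. word_at 0 k \<omega> \<in> V} = {\<omega>. word_at 0 (k + k0) \<omega> \<in> V'}"
      unfolding V'_def by (rule cylinder_extend)
    have "\<delta> * measure N (space N \<inter> {\<omega>. word_at 0 (k + k0) \<omega> \<in> V'})
        = (\<Sum>w\<in>V' \<inter> {w. length w = k + k0}. \<delta> * word_prob g y w)"
      unfolding measure_Int_cylinder[OF N.finite_measure_axioms sets sets.top]
      by (simp add: space forward_law_word[OF N] sum_distrib_left)
    also have "\<dots> \<le> (\<Sum>w\<in>V' \<inter> {w. length w = k + k0}. measure N (A \<inter> {\<omega>. word_at 0 (k + k0) \<omega> = w}))"
      by (intro sum_mono word) auto
    also have "\<dots> = measure N (A \<inter> {\<omega>. word_at 0 (k + k0) \<omega> \<in> V'})"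
      by (rule measure_Int_cylinder[OF N.finite_measure_axioms sets A_N, symmetric])
    finally show ?thesis unfolding B by (simp add: space)
  qed
  have "\<delta> * measure N (UNIV - A) \<le> e" if "e > 0" for e
  proof -
    have "UNIV - A \<in> sets (coord_algebra {0..})"
      using sets.compl_sets[OF tail_event_coord_algebra[OF A, of 0]] by simp
    \<comment> \<open>The error s is used twice, once as s for A \<inter> B and once as
      \<open>\<delta>\<close> s for the complement of \<open>A\<close>; this choice makes the total
      equal to \<open>e\<close>.\<close>
    moreover have "e / (1 + \<delta>) > 0" using that \<delta> by simp
    ultimately obtain k V where
      V: "measure N (sym_diff (UNIV - A) {\<omega>. word_at 0 k \<omega> \<in> V}) < e / (1 + \<delta>)"
      using cylinder_approx[OF N.finite_measure_axioms sets] by blast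
    let ?B = "{\<omega>. word_at 0 k \<omega> \<in> V}" and ?s = "e / (1 + \<delta>)"
    have Ac: "UNIV - A \<in> sets N" using sets.compl_sets[OF A_N] by (simp add: space)
    have "measure N (UNIV - A) \<le> measure N (?B \<union> sym_diff (UNIV - A) ?B)"
      using Ac cyl by (intro N.finite_measure_mono) auto
    also have "\<dots> \<le> measure N ?B + measure N (sym_diff (UNIV - A) ?B)"
      using Ac cyl by (intro measure_Un_le) auto
    finally have "measure N (UNIV - A) \<le> measure N ?B + ?s" using V by linarith
    then have "\<delta> * measure N (UNIV - A) \<le> \<delta> * measure N ?B + \<delta> * ?s"
      using \<delta> by (metis distrib_left mult_left_mono less_imp_le)
    also have "\<delta> * measure N ?B \<le> measure N (A \<inter> ?B)" by (rule dense)
    also have "measure N (A \<inter> ?B) \<le> measure N (sym_diff (UNIV - A) ?B)"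
      using Ac cyl by (intro N.finite_measure_mono) auto
    also have "\<dots> \<le> ?s" using V by simp
    also have "?s + \<delta> * ?s = (1 + \<delta>) * ?s" by (simp only: distrib_right mult_1)
    also have "\<dots> = e" using \<delta> by simp
    finally show ?thesis by simp
  qed
  then have "\<delta> * measure N (UNIV - A) \<le> 0" by (rule field_le_epsilon[of _ 0, simplified])
  then have "measure N (space N - A) = 0"
    using \<delta> measure_nonneg[of N "UNIV - A"] by (simp add: space mult_le_0_iff)
  then show ?thesis using N.prob_compl[OF A_N] by simp
qed

theorem corollary2:
  fixes g :: "'s::finite \<Rightarrow> 's past \<Rightarrow> real"
  assumes "regular_kernel g"
    and "summable (\<lambda>k. (var (Suc k) g)\<^sup>2)"
  shows "dynamic_uniqueness g"
proof -
  define c where "c = (INF (a, x)\<in>UNIV. g a x)"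
  have g: "kernel g" and c: "c > 0"
    using assms(1) by (auto simp: regular_kernel_def strongly_nonnull_def c_def)
  have bdd: "bdd_below (range (\<lambda>(a, x). g a x))"
    using g by (intro bdd_belowI[of _ 0]) (auto simp: kernel_def)
  have le: "c \<le> g a x" for a x
    using cINF_lower[OF bdd, of "(a, x)"] by (simp add: c_def)
  \<comment> \<open>The criterion starts at k = 1, whereas the second moment bound also includes
    \<open>var 0 g\<close>, the letter drawn before the futures share any letter; one more term does
    not affect summability.\<close>
  have sum: "summable (\<lambda>k. (var k g)\<^sup>2)"
    using assms(2) by (subst (asm) summable_Suc_iff)
  note full = tail_event_full[OF g c le sum]
  show ?thesis
    unfolding dynamic_uniqueness_def
  proof (intro allI impI ballI)
    fix x y and M N :: "(int \<Rightarrow> 's) measure" and A :: "(int \<Rightarrow> 's) set"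
    assume "forward_law g x M" "forward_law g y N" and A: "A \<in> tail_events"
    \<comment> \<open>The lemma is applied in both directions, so a tail event has either measure 0
      under both laws or measure 1 under both.\<close>
    then have "measure M A > 0 \<Longrightarrow> measure N A = 1" "measure N A > 0 \<Longrightarrow> measure M A = 1"
      using full by blast+
    then show "measure M A = measure N A"
      using measure_nonneg[of M A] measure_nonneg[of N A]
      by (cases "measure M A > 0"; cases "measure N A > 0") (simp_all only: not_less antisym)
  qed
qed

end
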